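(* Let $l \ge 2$ and let $K_{n_1,\ldots,n_l}$ be a complete multipartite graph whose partite sets are denoted $N_1, N_2, \ldots, N_l$, with $|N_i| = n_i$, where $n_1,\ldots,n_l$ are positive integers. Let $s^* = \min\{s_1^*, \ldots, s_l^*\}$, where $s_i^*$ is the minimum positive integer such that $s_i^* \nmid n_i$. Consider the following algorithm. (0) Set $h = s^*$. (1) If there are $n_i$ and $n_j$, with $i \neq j$, such that $h$ divides neither $n_i$ nor $n_j$, stop. Otherwise, go to (2). (2) There is $i$ such that $h \nmid n_i$, and $h \mid n_j$ for $j \neq i$. If $\frac{n_i}{h+1} > \left\lfloor \frac{n_i}{h} \right\rfloor$, stop. Otherwise, go to (3). (3) Let $h = h+1$, go to (1). The equitable chromatic threshold of $K_{n_1,\ldots,n_l}$ is $$\chi_=^*(K_{n_1,\ldots,n_l}) = \sum_{i=1}^l \left\lceil \frac{n_i}{h} \right\rceil,$$ where $h$ is the value at which the algorithm stops, and the complexity of the algorithm is linear in $|V(K_{n_1,\ldots,n_l})|$.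
   Context: Graphs are finite, undirected, without loops or multiple edges. The complete multipartite graph $K_{n_1,\ldots,n_l}$ has vertex set the disjoint union of the partite sets $N_1,\ldots,N_l$ with $|N_i| = n_i$, two vertices being adjacent if and only if they lie in different partite sets. For a positive integer $k$, write $[k]=\{1,\ldots,k\}$. A proper $k$-coloring of a graph $G$ is a map $f: V(G) \to [k]$ with $f(x) \neq f(y)$ whenever $xy \in E(G)$; its color classes are the sets $f^{-1}(i)$, $i \in [k]$. An equitable $k$-coloring of $G$ is a proper $k$-coloring in which any two color classes differ in size by at most one; $G$ is equitably $k$-colorable if it has an equitable $k$-coloring. The equitable chromatic threshold $\chi_=^*(G)$ is the minimum $t$ such that $G$ is equitably $k$-colorable for every $k \ge t$.
   Formalization: Step (2) asserts that some n_i is not divisible by h, which can fail (sizes 3, 6 at h = 3); in that case the algorithm is taken to go on to step (3). Linear complexity is counted in unit-cost arithmetic steps. *)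

theory Defs
  imports Complex_Main "Graph_Theory.Pair_Digraph"
begin

section \<open>Complete multipartite graphs\<close>

text \<open>
  Undirected simple graphs are the symmetric digraphs of the locale \<open>pair_graph\<close>.
  The list \<open>ns\<close> holds the sizes of the partite sets; these are indexed from 0.
\<close>

definition partite_set :: "nat list \<Rightarrow> nat \<Rightarrow> (nat \<times> nat) set" where
  "partite_set ns i = {i} \<times> {..<ns ! i}"

definition complete_multipartite :: "nat list \<Rightarrow> (nat \<times> nat) pair_pre_digraph" where
  "complete_multipartite ns = \<lparr>
     pverts = (\<Union>i<length ns. partite_set ns i),
     parcs = {(x, y). \<exists>i<length ns. \<exists>j<length ns.
                i \<noteq> j \<and> x \<in> partite_set ns i \<and> y \<in> partite_set ns j} \<rparr>"

lemma pair_graph_complete_multipartite: "pair_graph (complete_multipartite ns)"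
proof -
  have fin: "finite (pverts (complete_multipartite ns))"
    by (auto simp: complete_multipartite_def partite_set_def)
  have sub: "parcs (complete_multipartite ns)
      \<subseteq> pverts (complete_multipartite ns) \<times> pverts (complete_multipartite ns)"
    by (auto simp: complete_multipartite_def)
  show ?thesis
  proof
    show "finite (parcs (complete_multipartite ns))"
      using fin sub by (meson finite_SigmaI finite_subset)
    show "symmetric (with_proj (complete_multipartite ns))"
      by (auto simp: symmetric_def complete_multipartite_def intro!: symI)
  qed (use fin sub in \<open>auto simp: complete_multipartite_def partite_set_def\<close>)
qed

section \<open>Equitable colorings\<close>

definition proper_coloring :: "'a pair_pre_digraph \<Rightarrow> nat \<Rightarrow> ('a \<Rightarrow> nat) \<Rightarrow> bool" where
  "proper_coloring G k f \<longleftrightarrow>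
     (\<forall>x\<in>pverts G. f x \<in> {1..k}) \<and> (\<forall>(x, y)\<in>parcs G. f x \<noteq> f y)"

definition color_class :: "'a pair_pre_digraph \<Rightarrow> ('a \<Rightarrow> nat) \<Rightarrow> nat \<Rightarrow> 'a set" where
  "color_class G f c = {x \<in> pverts G. f x = c}"

definition equitable_coloring :: "'a pair_pre_digraph \<Rightarrow> nat \<Rightarrow> ('a \<Rightarrow> nat) \<Rightarrow> bool" where
  "equitable_coloring G k f \<longleftrightarrow> proper_coloring G k f \<and>
     (\<forall>c\<in>{1..k}. \<forall>d\<in>{1..k}. card (color_class G f c) \<le> card (color_class G f d) + 1)"

definition equitably_colorable :: "'a pair_pre_digraph \<Rightarrow> nat \<Rightarrow> bool" where
  "equitably_colorable G k \<longleftrightarrow> (\<exists>f. equitable_coloring G k f)"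

definition equitable_threshold :: "'a pair_pre_digraph \<Rightarrow> nat" where
  "equitable_threshold G = (LEAST t. 0 < t \<and> (\<forall>k\<ge>t. equitably_colorable G k))"

section \<open>The algorithm\<close>

definition least_nondivisor :: "nat \<Rightarrow> nat" where
  "least_nondivisor n = (LEAST s. 0 < s \<and> \<not> s dvd n)"

definition s_star :: "nat list \<Rightarrow> nat" where
  "s_star ns = Min {least_nondivisor (ns ! i) |i. i < length ns}"

text \<open>
  Step (2) can be reached with an \<open>h\<close> that divides every \<open>ns ! i\<close>: for the sizes 3, 6 the
  algorithm starts with \<open>h = 2\<close> and then passes to \<open>h = 3\<close>. There is no index \<open>i\<close> to test
  then, and the algorithm goes on to step (3).
\<close>

datatype control = Step1 nat | Step2 nat | Step3 nat | Stop nat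

fun alg_step :: "nat list \<Rightarrow> control \<Rightarrow> control" where
  "alg_step ns (Step1 h) =
     (if \<exists>i<length ns. \<exists>j<length ns. i \<noteq> j \<and> \<not> h dvd ns ! i \<and> \<not> h dvd ns ! j
      then Stop h else Step2 h)"
| "alg_step ns (Step2 h) =
     (if \<exists>i<length ns. \<not> h dvd ns ! i \<and> (\<forall>j<length ns. j \<noteq> i \<longrightarrow> h dvd ns ! j) \<and>
           real (ns ! i) / (real h + 1) > real_of_int \<lfloor>real (ns ! i) / real h\<rfloor>
      then Stop h else Step3 h)"
| "alg_step ns (Step3 h) = Step1 (h + 1)"
| "alg_step ns (Stop h) = Stop h"

definition alg_stops_at :: "nat list \<Rightarrow> nat \<Rightarrow> bool" where
  "alg_stops_at ns h \<longleftrightarrow> (\<exists>t. (alg_step ns ^^ t) (Step1 (s_star ns)) = Stop h)"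

section \<open>Running time\<close>

text \<open>
  The algorithm as a machine on the input array \<open>ns\<close>. Running time is the number of machine
  steps, and each step performs a bounded number of elementary operations (array access,
  comparison, and integer arithmetic at unit cost).

  \<^item> \<open>Init i s m\<close>: step (0). Trial division of \<open>ns ! i\<close> by \<open>s\<close>; \<open>m\<close> is the minimum of the
    least non-divisors of the entries before \<open>i\<close>, and \<open>0\<close> if there are none.
  \<^item> \<open>Scan h i u\<close>: step (1). The entries before \<open>i\<close> have been inspected; \<open>u\<close> is the index of
    the one that is not divisible by \<open>h\<close>, if any.
  \<^item> \<open>Test h i\<close>: step (2), where \<open>i\<close> is the only index with \<open>ns ! i\<close> not divisible by \<open>h\<close>. The
    inequality of step (2) is multiplied out.
  \<^item> \<open>Incr h\<close>: step (3).
\<close>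

datatype machine =
    Init nat nat nat
  | Scan nat nat "nat option"
  | Test nat nat
  | Incr nat
  | Halt nat

fun machine_step :: "nat list \<Rightarrow> machine \<Rightarrow> machine" where
  "machine_step ns (Init i s m) =
     (if i < length ns
      then if s dvd ns ! i then Init i (s + 1) m
           else Init (i + 1) 1 (if m = 0 then s else min m s)
      else Scan m 0 None)"
| "machine_step ns (Scan h i u) =
     (if i < length ns
      then if h dvd ns ! i then Scan h (i + 1) u
           else (case u of None \<Rightarrow> Scan h (i + 1) (Some i) | Some j \<Rightarrow> Halt h)
      else (case u of None \<Rightarrow> Incr h | Some j \<Rightarrow> Test h j))"
| "machine_step ns (Test h i) =
     (if ns ! i > (h + 1) * (ns ! i div h) then Halt h else Incr h)"
| "machine_step ns (Incr h) = Scan (h + 1) 0 None"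
| "machine_step ns (Halt h) = Halt h"

definition machine_halts_within :: "nat list \<Rightarrow> nat \<Rightarrow> nat \<Rightarrow> bool" where
  "machine_halts_within ns h b \<longleftrightarrow> (\<exists>t\<le>b. (machine_step ns ^^ t) (Init 0 1 0) = Halt h)"

end

theory Submission
  imports Defs
begin

text \<open>
  Every color class of a proper coloring lies in a single partite set. So an equitable
  \<open>k\<close>-coloring with class sizes \<open>q\<close> and \<open>q + 1\<close> amounts to cutting each partite set into
  blocks of these two sizes, \<open>k\<close> blocks in all (\<open>equitable_coloring_imp_splits\<close>,
  \<open>splits_imp_equitably_colorable\<close>). For \<open>q > 0\<close> a set of size \<open>n\<close> can be cut into \<open>m\<close> such blocks
  iff \<open>\<lceil>n / (q + 1)\<rceil> \<le> m \<le> \<lfloor>n / q\<rfloor>\<close>. Hence, if this range is nonempty for every partite set, the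
  values of \<open>k\<close> served by \<open>q\<close> form the interval from \<open>C (q + 1)\<close> to \<open>F q\<close>, where \<open>C\<close> and
  \<open>F\<close> are the sums of the rounded-up and rounded-down quotients of the sizes; otherwise \<open>q\<close>
  serves no \<open>k\<close>. The value \<open>q = 0\<close> serves all \<open>k\<close> from \<open>C 1\<close>, the number of vertices, on.

  As \<open>q\<close> grows the intervals move down. Those of \<open>q - 1\<close> and \<open>q\<close> leave a gap iff
  \<open>C q > F q + 1\<close>, that is, iff \<open>q\<close> fails to divide two of the sizes; and the interval of \<open>q\<close>
  is missing iff \<open>\<lfloor>n / q\<rfloor> < n / (q + 1)\<close> for some size \<open>n\<close>. These are the two reasons for
  which the algorithm stops, and \<open>obstructs\<close> is their disjunction. If \<open>h\<close> is the least
  positive obstruction, everything from \<open>C h\<close> on is covered (\<open>splits_above\<close>), while \<open>C h - 1\<close> is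
  served by no \<open>q\<close> (\<open>not_splits_below\<close>). No positive number below \<open>s\<^sup>*\<close> obstructs, because it
  divides all sizes; so it does no harm that the algorithm starts at \<open>s\<^sup>*\<close>.

  The running time is linear because a value \<open>h\<close> that the algorithm passes divides all sizes
  but at most one. With \<open>l\<close> parts and \<open>N\<close> vertices this gives \<open>(l - 1) h \<le> N\<close>
  (\<open>not_obstructs_bound\<close>), so about \<open>h\<close> rounds of \<open>l + 3\<close> machine steps cost \<open>O(N)\<close>.
\<close>

section \<open>Rounded quotients\<close>

definition ceil_div :: "nat \<Rightarrow> nat \<Rightarrow> nat" where
  "ceil_div n q = nat \<lceil>real n / real q\<rceil>"

lemma ceil_div_le_iff:
  assumes "0 < q"
  shows "ceil_div n q \<le> k \<longleftrightarrow> n \<le> q * k"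
proof -
  have "ceil_div n q \<le> k \<longleftrightarrow> real n / real q \<le> real k"
    by (simp add: ceil_div_def nat_le_iff ceiling_le_iff)
  also have "\<dots> \<longleftrightarrow> real n \<le> real (q * k)"
    using assms by (simp add: pos_divide_le_eq mult.commute)
  finally show ?thesis by (simp only: of_nat_le_iff)
qed

lemma int_ceil_div: "int (ceil_div n q) = \<lceil>real n / real q\<rceil>"
proof -
  have "0 \<le> real n / real q" by simp
  hence "0 \<le> \<lceil>real n / real q\<rceil>" by linarith
  thus ?thesis by (simp add: ceil_div_def)
qed

lemma le_div_iff:
  fixes q :: nat
  assumes "0 < q"
  shows "k \<le> n div q \<longleftrightarrow> q * k \<le> n"
  using assms by (simp add: less_eq_div_iff_mult_less_eq mult.commute)

lemma ceil_div_eq: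
  assumes "0 < q"
  shows "ceil_div n q = n div q + of_bool (\<not> q dvd n)"
proof (rule antisym)
  show "ceil_div n q \<le> n div q + of_bool (\<not> q dvd n)"
    using assms by (auto simp: ceil_div_le_iff dividend_less_times_div[THEN less_imp_le])
  have "n div q \<le> ceil_div n q"
    using assms ceil_div_le_iff[of q n "ceil_div n q"]
    by (metis div_le_mono nonzero_mult_div_cancel_left not_gr_zero order_refl)
  moreover have "q dvd n" if "n div q = ceil_div n q"
  proof -
    have "n \<le> q * (n div q)"
      using ceil_div_le_iff[OF assms, of n "n div q"] that by simp
    thus ?thesis by (metis div_times_less_eq_dividend dvd_triv_left le_antisym mult.commute)
  qed
  ultimately show "n div q + of_bool (\<not> q dvd n) \<le> ceil_div n q"
    by (cases "q dvd n") (auto simp: le_less)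
qed

lemma sum_ceil_div_eq:
  assumes "0 < q"
  shows "(\<Sum>i<length ns. ceil_div (ns ! i) q) =
    (\<Sum>i<length ns. ns ! i div q) + card {i. i < length ns \<and> \<not> q dvd ns ! i}"
proof -
  have "{i. i < length ns \<and> \<not> q dvd ns ! i} = {..<length ns} \<inter> {i. \<not> q dvd ns ! i}"
    by auto
  thus ?thesis
    using assms by (simp add: ceil_div_eq sum.distrib sum_of_bool_eq)
qed

text \<open>
  A discrete intermediate value property: it turns separate ranges for the block numbers of the
  parts into an interval of values for their total.
\<close>

lemma exists_between_sum:
  fixes a b :: "'i \<Rightarrow> nat"
  assumes "finite I" "\<forall>i\<in>I. a i \<le> b i" "sum a I \<le> k" "k \<le> sum b I"
  shows "\<exists>m. sum m I = k \<and> (\<forall>i\<in>I. a i \<le> m i \<and> m i \<le> b i)"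
  using assms
proof (induction I arbitrary: k rule: finite_induct)
  case empty
  thus ?case by simp
next
  case (insert x I)
  \<comment> \<open>The new index receives as much as the other indices can spare.\<close>
  define y where "y = min (b x) (k - sum a I)"
  have y: "a x \<le> y" "y \<le> b x" "sum a I \<le> k - y" "k - y \<le> sum b I" "y \<le> k"
    using insert.prems insert.hyps sum_mono[of I a b] by (auto simp: y_def)
  then obtain m where m: "sum m I = k - y" "\<forall>i\<in>I. a i \<le> m i \<and> m i \<le> b i"
    using insert.IH[of "k - y"] insert.prems by auto
  have "sum (m(x := y)) I = sum m I"
    using insert.hyps by (intro sum.cong) auto
  hence "sum (m(x := y)) (insert x I) = k"
    using insert.hyps m(1) y by simp
  moreover have "\<forall>i\<in>insert x I. a i \<le> (m(x := y)) i \<and> (m(x := y)) i \<le> b i"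
    using m(2) y by simp
  ultimately show ?case by blast
qed

section \<open>Equitable colorings of a complete multipartite graph\<close>

text \<open>
  The number \<open>m i\<close> counts the blocks of size \<open>q\<close> or \<open>q + 1\<close> into which the \<open>i\<close>-th partite
  set is cut. For \<open>q = 0\<close> the blocks of size 0 stand for unused colors.
\<close>

definition splits :: "nat list \<Rightarrow> nat \<Rightarrow> nat \<Rightarrow> bool" where
  "splits ns k q \<longleftrightarrow> (\<exists>m. (\<Sum>i<length ns. m i) = k \<and>
     (\<forall>i<length ns. q * m i \<le> ns ! i \<and> ns ! i \<le> (q + 1) * m i))"

lemma finite_partite_set: "finite (partite_set ns i)"
  by (simp add: partite_set_def)

lemma card_partite_set: "card (partite_set ns i) = ns ! i"
  by (simp add: partite_set_def card_cartesian_product_singleton)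

lemma pverts_complete_multipartite:
  "pverts (complete_multipartite ns) = (\<Union>i<length ns. partite_set ns i)"
  by (simp add: complete_multipartite_def)

lemma partite_set_eqI: "x \<in> partite_set ns i \<Longrightarrow> x \<in> partite_set ns j \<Longrightarrow> i = j"
  by (auto simp: partite_set_def)

lemma card_pverts_complete_multipartite:
  "card (pverts (complete_multipartite ns)) = (\<Sum>i<length ns. ns ! i)"
  unfolding pverts_complete_multipartite
  by (subst card_UN_disjoint)
     (auto simp: finite_partite_set card_partite_set dest: partite_set_eqI)

text \<open>
  Vertices in different partite sets are adjacent, so one vertex of the class determines the
  partite set; an empty class lies in any of them, which requires that there is one.
\<close>

lemma color_class_in_partite_set:
  assumes "proper_coloring (complete_multipartite ns) k f" "ns \<noteq> []"
  shows "\<exists>i<length ns. color_class (complete_multipartite ns) f c \<subseteq> partite_set ns i"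
proof (cases "color_class (complete_multipartite ns) f c = {}")
  case True
  thus ?thesis using assms(2) by auto
next
  case False
  then obtain x where x: "x \<in> pverts (complete_multipartite ns)" "f x = c"
    by (auto simp: color_class_def)
  then obtain i where i: "i < length ns" "x \<in> partite_set ns i"
    by (auto simp: pverts_complete_multipartite)
  have "y \<in> partite_set ns i" if y: "y \<in> color_class (complete_multipartite ns) f c" for y
  proof (rule ccontr)
    assume ny: "y \<notin> partite_set ns i"
    obtain j where j: "j < length ns" "y \<in> partite_set ns j"
      using y by (auto simp: color_class_def pverts_complete_multipartite)
    with ny i have "(x, y) \<in> parcs (complete_multipartite ns)"
      by (auto simp: complete_multipartite_def)
    hence "f x \<noteq> f y" using assms(1) by (auto simp: proper_coloring_def)
    thus False using x y by (simp add: color_class_def)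
  qed
  thus ?thesis using i by blast
qed

text \<open>
  Each color is charged to one partite set containing its class, unused colors included, so that
  the block numbers add up to exactly \<open>k\<close>.
\<close>

lemma equitable_coloring_imp_splits:
  assumes eq: "equitable_coloring (complete_multipartite ns) k f"
    and k: "0 < k" and ne: "ns \<noteq> []"
  shows "\<exists>q. splits ns k q"
proof -
  let ?C = "color_class (complete_multipartite ns) f"
  have proper: "proper_coloring (complete_multipartite ns) k f"
    and bal: "\<And>c d. c \<in> {1..k} \<Longrightarrow> d \<in> {1..k} \<Longrightarrow> card (?C c) \<le> card (?C d) + 1"
    using eq by (auto simp: equitable_coloring_def)
  obtain p where p: "\<And>c. p c < length ns" "\<And>c. ?C c \<subseteq> partite_set ns (p c)"
    using color_class_in_partite_set[OF proper ne] by metis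
  have "1 \<in> {1..k}" using k by simp
  then obtain d where d: "d \<in> {1..k}" "\<And>c. c \<in> {1..k} \<Longrightarrow> card (?C d) \<le> card (?C c)"
    using ex_has_least_nat[of "\<lambda>c. c \<in> {1..k}" 1 "\<lambda>c. card (?C c)"] by blast
  define q where "q = card (?C d)"
  have size: "q \<le> card (?C c)" "card (?C c) \<le> q + 1" if "c \<in> {1..k}" for c
    using d bal that by (auto simp: q_def)
  define m where "m i = card {c \<in> {1..k}. p c = i}" for i
  have "(\<Sum>i<length ns. m i) = (\<Sum>i<length ns. \<Sum>c\<in>{c \<in> {1..k}. p c = i}. 1)"
    by (simp add: m_def)
  also have "\<dots> = (\<Sum>c\<in>{1..k}. 1)"
    using p(1) by (intro sum.group) auto
  finally have "(\<Sum>i<length ns. m i) = k" by simp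
  moreover have "q * m i \<le> ns ! i \<and> ns ! i \<le> (q + 1) * m i" if i: "i < length ns" for i
  proof -
    have "partite_set ns i = (\<Union>c\<in>{c \<in> {1..k}. p c = i}. ?C c)"
    proof (intro set_eqI iffI)
      fix x assume x: "x \<in> partite_set ns i"
      hence v: "x \<in> pverts (complete_multipartite ns)"
        using i by (auto simp: pverts_complete_multipartite)
      hence "x \<in> ?C (f x)" by (simp add: color_class_def)
      moreover have "p (f x) = i"
        using calculation p(2) x partite_set_eqI by blast
      moreover have "f x \<in> {1..k}" using proper v by (simp add: proper_coloring_def)
      ultimately show "x \<in> (\<Union>c\<in>{c \<in> {1..k}. p c = i}. ?C c)" by blast
    qed (use p(2) in auto)
    hence "ns ! i = card (\<Union>c\<in>{c \<in> {1..k}. p c = i}. ?C c)"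
      by (metis card_partite_set)
    also have "\<dots> = (\<Sum>c\<in>{c \<in> {1..k}. p c = i}. card (?C c))"
    proof (rule card_UN_disjoint)
      show "\<forall>c\<in>{c \<in> {1..k}. p c = i}. finite (?C c)"
        using p(2) finite_partite_set finite_subset by blast
    qed (auto simp: color_class_def)
    finally have n: "ns ! i = (\<Sum>c\<in>{c \<in> {1..k}. p c = i}. card (?C c))" .
    show ?thesis
      unfolding n m_def
      using sum_bounded_below[of "{c \<in> {1..k}. p c = i}" q "\<lambda>c. card (?C c)"]
        sum_bounded_above[of "{c \<in> {1..k}. p c = i}" "\<lambda>c. card (?C c)" "q + 1"] size
      by (simp add: mult.commute)
  qed
  ultimately show ?thesis unfolding splits_def by blast
qed

text \<open>
  Dealing out \<open>n\<close> items to \<open>m\<close> recipients in turn is fair. This supplies the cut of a partite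
  set into \<open>m\<close> blocks.
\<close>

lemma card_residue_class_bounds:
  fixes n m q r :: nat
  assumes "q * m \<le> n" "n \<le> (q + 1) * m" "r < m"
  shows "q \<le> card {j. j < n \<and> j mod m = r}" "card {j. j < n \<and> j mod m = r} \<le> q + 1"
proof -
  let ?R = "{j. j < n \<and> j mod m = r}"
  have inj: "inj_on (\<lambda>t. r + m * t) A" for A
    using assms(3) by (auto simp: inj_on_def)
  have "r + m * t < n" if "t < q" for t
  proof -
    have "r + m * t < m * (t + 1)" using assms(3) by simp
    also have "\<dots> \<le> m * q" using that by (intro mult_le_mono) auto
    also have "\<dots> \<le> n" using assms(1) by (simp add: mult.commute)
    finally show ?thesis .
  qed
  hence "(\<lambda>t. r + m * t) ` {..<q} \<subseteq> ?R"
    using assms(3) by auto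
  hence "card ((\<lambda>t. r + m * t) ` {..<q}) \<le> card ?R" by (intro card_mono) auto
  thus "q \<le> card ?R" by (simp add: card_image[OF inj])
  have "?R \<subseteq> (\<lambda>t. r + m * t) ` {..<q + 1}"
  proof
    fix j assume j: "j \<in> ?R"
    hence "j < (q + 1) * m" using assms(2) by simp
    hence "j div m < q + 1" by (simp add: less_mult_imp_div_less)
    moreover have "j = r + m * (j div m)" using j by auto
    ultimately show "j \<in> (\<lambda>t. r + m * t) ` {..<q + 1}" by blast
  qed
  hence "card ?R \<le> card ((\<lambda>t. r + m * t) ` {..<q + 1})" by (intro card_mono) auto
  thus "card ?R \<le> q + 1" by (simp add: card_image[OF inj])
qed

lemma splits_imp_equitably_colorable:
  assumes "splits ns k q"
  shows "equitably_colorable (complete_multipartite ns) k"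
proof -
  obtain m where sum: "(\<Sum>i<length ns. m i) = k"
    and m: "\<And>i. i < length ns \<Longrightarrow> q * m i \<le> ns ! i \<and> ns ! i \<le> (q + 1) * m i"
    using assms by (auto simp: splits_def)
  \<comment> \<open>The colors are pairs of a part and a residue, numbered through an arbitrary bijection.\<close>
  define P where "P = (SIGMA i:{..<length ns}. {..<m i})"
  have "finite P" "card P = card {1..k}" using sum by (auto simp: P_def)
  then obtain b where b: "bij_betw b P {1..k}"
    using finite_same_card_bij[of P "{1..k}"] by auto
  define f where "f = (\<lambda>(i, j). b (i, j mod m i))"
  have in_P: "(i, j mod m i) \<in> P" if "i < length ns" "j < ns ! i" for i j
  proof -
    have "0 < m i" using m[OF that(1)] that(2) by (cases "m i") auto
    thus ?thesis using that by (simp add: P_def)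
  qed
  have b_eq: "b x = b y \<longleftrightarrow> x = y" if "x \<in> P" "y \<in> P" for x y
    using b that by (auto simp: bij_betw_def inj_on_def)
  have "proper_coloring (complete_multipartite ns) k f"
    unfolding proper_coloring_def
  proof (intro conjI ballI)
    fix x assume "x \<in> pverts (complete_multipartite ns)"
    thus "f x \<in> {1..k}"
      using in_P bij_betwE[OF b] by (auto simp: f_def complete_multipartite_def partite_set_def)
  next
    fix e assume "e \<in> parcs (complete_multipartite ns)"
    thus "case e of (x, y) \<Rightarrow> f x \<noteq> f y"
      using in_P by (auto simp: f_def complete_multipartite_def partite_set_def b_eq)
  qed
  moreover have size: "q \<le> card (color_class (complete_multipartite ns) f c) \<and>
      card (color_class (complete_multipartite ns) f c) \<le> q + 1" if c: "c \<in> {1..k}" for c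
  proof -
    obtain i r where ir: "(i, r) \<in> P" "c = b (i, r)"
      using b c by (metis bij_betw_iff_bijections surj_pair)
    hence i: "i < length ns" and r: "r < m i" by (auto simp: P_def)
    have "color_class (complete_multipartite ns) f c =
        {i} \<times> {j. j < ns ! i \<and> j mod m i = r}"
      using in_P ir i
      by (auto simp: color_class_def pverts_complete_multipartite partite_set_def f_def b_eq)
    thus ?thesis
      using card_residue_class_bounds[of q "m i" "ns ! i" r] m[OF i] r
      by (simp add: card_cartesian_product_singleton)
  qed
  ultimately have "equitable_coloring (complete_multipartite ns) k f"
    unfolding equitable_coloring_def by (meson add_le_mono1 le_trans)
  thus ?thesis by (auto simp: equitably_colorable_def)
qed

section \<open>The threshold\<close>

text \<open>
  The two stopping conditions of the algorithm merged into one. In step (2) the other sizes are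
  divisible by \<open>h\<close>; where this fails for the index of the second disjunct, the first one holds.
\<close>

definition obstructs :: "nat list \<Rightarrow> nat \<Rightarrow> bool" where
  "obstructs ns h \<longleftrightarrow>
     (\<exists>i<length ns. \<exists>j<length ns. i \<noteq> j \<and> \<not> h dvd ns ! i \<and> \<not> h dvd ns ! j) \<or>
     (\<exists>i<length ns. \<not> h dvd ns ! i \<and> (h + 1) * (ns ! i div h) < ns ! i)"

lemma not_obstructs_le:
  assumes "\<not> obstructs ns q" "i < length ns"
  shows "ns ! i \<le> (q + 1) * (ns ! i div q)"
proof (cases "q dvd ns ! i")
  case True
  thus ?thesis by simp
next
  case False
  hence "\<not> (q + 1) * (ns ! i div q) < ns ! i"
    using assms unfolding obstructs_def by blast
  thus ?thesis by simp
qed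

lemma card_nondivisible_le_1:
  assumes "\<not> obstructs ns q"
  shows "card {i. i < length ns \<and> \<not> q dvd ns ! i} \<le> 1"
  using assms by (intro card_le_Suc0_iff_eq[THEN iffD2, folded One_nat_def])
    (auto simp: obstructs_def)

text \<open>
  Take the least \<open>g\<close> whose sum of rounded-up quotients is at most \<open>k\<close>, and \<open>q = g - 1\<close>. Then
  \<open>k\<close> is below the sum for \<open>q\<close>, and since \<open>q\<close> leaves a remainder in at most one size, this
  sum exceeds that of the rounded-down quotients by at most one. So \<open>k\<close> lies in the interval
  served by \<open>q\<close>.
\<close>

lemma splits_above:
  assumes ne: "ns \<noteq> []" and h: "0 < h"
    and free: "\<And>q. 0 < q \<Longrightarrow> q < h \<Longrightarrow> \<not> obstructs ns q"
    and k: "(\<Sum>i<length ns. ceil_div (ns ! i) h) \<le> k"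
  shows "\<exists>q. splits ns k q"
proof -
  define g where "g = (LEAST g. 0 < g \<and> (\<Sum>i<length ns. ceil_div (ns ! i) g) \<le> k)"
  have g: "0 < g" "(\<Sum>i<length ns. ceil_div (ns ! i) g) \<le> k"
    using LeastI[of "\<lambda>g. 0 < g \<and> (\<Sum>i<length ns. ceil_div (ns ! i) g) \<le> k" h] h k
    by (auto simp: g_def)
  have g_le: "g \<le> h"
    unfolding g_def using h k by (intro Least_le) auto
  define q where "q = g - 1"
  have q: "g = q + 1" using g by (simp add: q_def)
  \<comment> \<open>For \<open>q = 0\<close> the number of blocks is unbounded; the summand \<open>k\<close> makes the bound harmless.\<close>
  define up where "up i = (if q = 0 then ceil_div (ns ! i) g + k else ns ! i div q)" for i
  have "\<forall>i\<in>{..<length ns}. ceil_div (ns ! i) g \<le> up i"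
  proof
    fix i assume "i \<in> {..<length ns}"
    thus "ceil_div (ns ! i) g \<le> up i"
      using free[of q] g_le not_obstructs_le[of ns q i] ceil_div_le_iff[of g "ns ! i" "ns ! i div q"]
      by (cases "q = 0") (auto simp: up_def q)
  qed
  moreover have "k \<le> (\<Sum>i<length ns. up i)"
  proof (cases "q = 0")
    case True
    have "k \<le> up 0" by (simp add: up_def True)
    also have "\<dots> \<le> (\<Sum>i<length ns. up i)" using ne by (intro member_le_sum) auto
    finally show ?thesis .
  next
    case False
    have "k < (\<Sum>i<length ns. ceil_div (ns ! i) q)"
      using not_less_Least[of q "\<lambda>g. 0 < g \<and> (\<Sum>i<length ns. ceil_div (ns ! i) g) \<le> k"]
        False q by (auto simp: g_def)
    thus ?thesis
      using sum_ceil_div_eq[of q ns] card_nondivisible_le_1[of ns q] free[of q] False g_le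
      by (simp add: up_def q)
  qed
  ultimately obtain m where m: "sum m {..<length ns} = k"
      "\<forall>i\<in>{..<length ns}. ceil_div (ns ! i) g \<le> m i \<and> m i \<le> up i"
    using exists_between_sum[of "{..<length ns}" "\<lambda>i. ceil_div (ns ! i) g" up k] g(2) by auto
  have "splits ns k q"
    unfolding splits_def
  proof (intro exI[of _ m] conjI allI impI)
    fix i assume i: "i < length ns"
    show "q * m i \<le> ns ! i"
      using m(2) i by (cases "q = 0") (auto simp: up_def le_div_iff)
    show "ns ! i \<le> (q + 1) * m i"
      using m(2) i ceil_div_le_iff[of "q + 1"] by (auto simp: q)
  qed (use m in simp)
  thus ?thesis by blast
qed

text \<open>
  A block size \<open>q < h\<close> needs at least as many blocks as there are in the sum for \<open>h\<close>. A size
  \<open>q \<ge> h\<close> allows at most \<open>\<lfloor>n / h\<rfloor>\<close> blocks per part, which is too few in total if two sizes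
  leave a remainder. If only one does, equality is forced in every part: then \<open>q = h\<close>
  contradicts the obstruction, and \<open>q > h\<close> is impossible in a part whose size \<open>h\<close> divides;
  such a part exists because there are at least two.
\<close>

lemma not_splits_below:
  assumes len: "2 \<le> length ns" and pos: "\<forall>n\<in>set ns. 0 < n" and h: "0 < h"
    and obs: "obstructs ns h"
    and k: "(\<Sum>i<length ns. ceil_div (ns ! i) h) = Suc k"
  shows "\<not> splits ns k q"
proof
  assume "splits ns k q"
  then obtain m where sum: "(\<Sum>i<length ns. m i) = k"
    and m: "\<And>i. i < length ns \<Longrightarrow> q * m i \<le> ns ! i"
      "\<And>i. i < length ns \<Longrightarrow> ns ! i \<le> (q + 1) * m i"
    by (auto simp: splits_def)
  show False
  proof (cases "q < h")
    case True
    have "ceil_div (ns ! i) h \<le> m i" if "i < length ns" for i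
    proof -
      have "(q + 1) * m i \<le> h * m i" using True by (intro mult_le_mono1) simp
      thus ?thesis using m(2)[OF that] h by (simp add: ceil_div_le_iff)
    qed
    hence "(\<Sum>i<length ns. ceil_div (ns ! i) h) \<le> (\<Sum>i<length ns. m i)"
      by (intro sum_mono) auto
    thus False using sum k by simp
  next
    case False
    have le: "m i \<le> ns ! i div h" if "i < length ns" for i
    proof -
      have "h * m i \<le> q * m i" using False by (intro mult_le_mono1) simp
      hence "h * m i \<le> ns ! i" using m(1)[OF that] by (rule le_trans)
      thus ?thesis using h by (simp add: le_div_iff)
    qed
    let ?D = "{i. i < length ns \<and> \<not> h dvd ns ! i}"
    have fin: "finite ?D" by simp
    have "k \<le> (\<Sum>i<length ns. ns ! i div h)"
      unfolding sum[symmetric] using le by (intro sum_mono) auto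
    hence D1: "card ?D \<le> 1" and eq_if: "card ?D \<noteq> 0 \<Longrightarrow> (\<Sum>i<length ns. ns ! i div h) = k"
      using k sum_ceil_div_eq[OF h, of ns] by linarith+
    hence uniq: "i = j" if "i \<in> ?D" "j \<in> ?D" for i j
      using that card_le_Suc0_iff_eq[OF fin] by auto
    with obs obtain i where i: "i < length ns" "\<not> h dvd ns ! i"
        "(h + 1) * (ns ! i div h) < ns ! i"
      unfolding obstructs_def by blast
    have "card ?D \<noteq> 0" using i(1,2) by (simp only: card_0_eq[OF fin]) blast
    hence "(\<Sum>i<length ns. m i) = (\<Sum>i<length ns. ns ! i div h)"
      using eq_if sum by simp
    hence eq: "m j = ns ! j div h" if "j < length ns" for j
      using sum_mono_inv[of m "{..<length ns}" "\<lambda>i. ns ! i div h" j] le that by auto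
    have "q \<noteq> h" using m(2)[OF i(1)] i(3) eq[OF i(1)] by auto
    hence "h < q" using False by simp
    obtain j where j: "j < length ns" "j \<noteq> i"
      using len by (metis One_nat_def less_2_cases_iff less_le_trans n_not_Suc_n)
    hence "h dvd ns ! j" using uniq[of i j] i by auto
    hence nj: "ns ! j = h * m j" using eq[OF j(1)] by simp
    moreover have "0 < ns ! j" using pos j by simp
    ultimately have "ns ! j < q * m j" using \<open>h < q\<close> by simp
    thus False using m(1)[OF j(1)] by simp
  qed
qed

lemma equitable_threshold_eq:
  assumes len: "2 \<le> length ns" and pos: "\<forall>n\<in>set ns. 0 < n" and h: "0 < h"
    and obs: "obstructs ns h" and free: "\<And>q. 0 < q \<Longrightarrow> q < h \<Longrightarrow> \<not> obstructs ns q"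
  shows "equitable_threshold (complete_multipartite ns) =
    (\<Sum>i<length ns. ceil_div (ns ! i) h)"
proof -
  let ?G = "complete_multipartite ns" and ?T = "\<Sum>i<length ns. ceil_div (ns ! i) h"
  have ne: "ns \<noteq> []" using len by auto
  have "(\<Sum>i<length ns. 1) \<le> ?T"
  proof (rule sum_mono)
    fix i assume "i \<in> {..<length ns}"
    hence "0 < ns ! i" using pos by simp
    hence "\<not> ceil_div (ns ! i) h \<le> 0" using ceil_div_le_iff[OF h, of "ns ! i" 0] by simp
    thus "1 \<le> ceil_div (ns ! i) h" by simp
  qed
  hence T: "2 \<le> ?T" using len by simp
  have not: "\<not> equitably_colorable ?G (?T - 1)"
  proof
    assume "equitably_colorable ?G (?T - 1)"
    then obtain q where "splits ns (?T - 1) q"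
      using equitable_coloring_imp_splits[of ns "?T - 1"] ne T
      by (auto simp: equitably_colorable_def)
    thus False using not_splits_below[OF len pos h obs, of "?T - 1" q] T by simp
  qed
  show ?thesis
    unfolding equitable_threshold_def
  proof (rule Least_equality)
    show "0 < ?T \<and> (\<forall>k\<ge>?T. equitably_colorable ?G k)"
      using T splits_above[OF ne h free] splits_imp_equitably_colorable by fastforce
  next
    fix t assume t: "0 < t \<and> (\<forall>k\<ge>t. equitably_colorable ?G k)"
    show "?T \<le> t"
    proof (rule ccontr)
      assume "\<not> ?T \<le> t"
      hence "t \<le> ?T - 1" by simp
      thus False using t not by blast
    qed
  qed
qed

section \<open>Where the algorithm stops\<close>

lemma obstructs_large:
  assumes len: "2 \<le> length ns" and pos: "\<forall>n\<in>set ns. 0 < n" and h: "\<forall>n\<in>set ns. n < h"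
  shows "obstructs ns h"
proof -
  have "\<not> h dvd ns ! i" if "i < length ns" for i
    using pos h that nat_dvd_not_less[of "ns ! i" h] by simp
  from this[of 0] this[of 1] have "\<not> h dvd ns ! 0" "\<not> h dvd ns ! 1" using len by linarith+
  moreover have "0 < length ns" "1 < length ns" "(0::nat) \<noteq> 1" using len by auto
  ultimately show ?thesis unfolding obstructs_def by blast
qed

lemma least_nondivisor_props:
  assumes "0 < n"
  shows "0 < least_nondivisor n" "\<not> least_nondivisor n dvd n" "least_nondivisor n \<le> n + 1"
proof -
  have ex: "0 < Suc n \<and> \<not> Suc n dvd n" using assms nat_dvd_not_less by blast
  show "0 < least_nondivisor n" "\<not> least_nondivisor n dvd n"
    using LeastI[of "\<lambda>s. 0 < s \<and> \<not> s dvd n" "Suc n"] ex by (auto simp: least_nondivisor_def)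
  show "least_nondivisor n \<le> n + 1"
    unfolding least_nondivisor_def using ex by (intro Least_le) simp
qed

lemma dvd_if_less_least_nondivisor:
  "0 < q \<Longrightarrow> q < least_nondivisor n \<Longrightarrow> q dvd n"
  unfolding least_nondivisor_def using not_less_Least by blast

lemma s_star_le:
  "i < length ns \<Longrightarrow> s_star ns \<le> least_nondivisor (ns ! i)"
  unfolding s_star_def by (intro Min_le) auto

lemma s_star_pos:
  assumes "ns \<noteq> []" "\<forall>n\<in>set ns. 0 < n"
  shows "0 < s_star ns"
proof -
  have "s_star ns \<in> {least_nondivisor (ns ! i) |i. i < length ns}"
    unfolding s_star_def using assms(1) by (intro Min_in) auto
  thus ?thesis using assms(2) least_nondivisor_props(1) by auto
qed

lemma not_obstructs_below_s_star:
  assumes "0 < q" "q < s_star ns"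
  shows "\<not> obstructs ns q"
proof -
  have "q dvd ns ! i" if "i < length ns" for i
    using assms s_star_le[OF that] dvd_if_less_least_nondivisor[of q "ns ! i"] by simp
  thus ?thesis by (auto simp: obstructs_def)
qed

lemma step2_test_iff:
  assumes "0 < h"
  shows "real n / (real h + 1) > real_of_int \<lfloor>real n / real h\<rfloor> \<longleftrightarrow> (h + 1) * (n div h) < n"
proof -
  have "\<lfloor>real n / real h\<rfloor> = int (n div h)"
    by (rule floor_divide_of_nat_eq)
  hence "real n / (real h + 1) > real_of_int \<lfloor>real n / real h\<rfloor> \<longleftrightarrow>
      real ((h + 1) * (n div h)) < real n"
    by (simp add: pos_less_divide_eq algebra_simps)
  thus ?thesis by (simp only: of_nat_less_iff)
qed

text \<open>
  Step (2) is also reached when \<open>h\<close> divides all sizes; \<open>obstructs\<close> is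
  false in this case, and the round passes on to \<open>h + 1\<close>.
\<close>

lemma alg_round:
  assumes "0 < h"
  shows "(alg_step ns ^^ 3) (Step1 h) = (if obstructs ns h then Stop h else Step1 (h + 1))"
proof -
  define A where "A \<longleftrightarrow>
    (\<exists>i<length ns. \<exists>j<length ns. i \<noteq> j \<and> \<not> h dvd ns ! i \<and> \<not> h dvd ns ! j)"
  define B where "B \<longleftrightarrow>
    (\<exists>i<length ns. \<not> h dvd ns ! i \<and> (\<forall>j<length ns. j \<noteq> i \<longrightarrow> h dvd ns ! j) \<and>
       real (ns ! i) / (real h + 1) > real_of_int \<lfloor>real (ns ! i) / real h\<rfloor>)"
  have "obstructs ns h \<longleftrightarrow> A \<or> B"
    unfolding obstructs_def A_def B_def step2_test_iff[OF assms] by blast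
  moreover have "alg_step ns (Step1 h) = (if A then Stop h else Step2 h)"
    by (simp only: alg_step.simps A_def)
  moreover have "alg_step ns (Step2 h) = (if B then Stop h else Step3 h)"
    by (simp only: alg_step.simps B_def)
  moreover have "(alg_step ns ^^ 3) c = alg_step ns (alg_step ns (alg_step ns c))" for c
    by (simp add: numeral_3_eq_3)
  ultimately show ?thesis by (cases A; cases B) (simp_all only: alg_step.simps if_True if_False simp_thms)
qed

lemma alg_reaches:
  assumes "0 < s" "s \<le> h" "\<And>q. s \<le> q \<Longrightarrow> q < h \<Longrightarrow> \<not> obstructs ns q"
  shows "\<exists>t. (alg_step ns ^^ t) (Step1 s) = Step1 h"
  using assms(2,3)
proof (induction h rule: dec_induct)
  case base
  show ?case by (rule exI[of _ 0]) simp
next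
  case (step h)
  then obtain t where "(alg_step ns ^^ t) (Step1 s) = Step1 h" by auto
  hence "(alg_step ns ^^ (3 + t)) (Step1 s) = Step1 (Suc h)"
    unfolding funpow_add using alg_round[of h ns] step assms(1) by simp
  thus ?case by blast
qed

lemma alg_stays: "(alg_step ns ^^ t) (Stop h) = Stop h"
  by (induction t) auto

lemma alg_stops_at_unique:
  assumes "alg_stops_at ns h" "alg_stops_at ns h'"
  shows "h = h'"
proof -
  have *: "x = y" if "(alg_step ns ^^ t) c = Stop x" "(alg_step ns ^^ u) c = Stop y" "t \<le> u"
    for t u x y c
  proof -
    have "(alg_step ns ^^ u) c = (alg_step ns ^^ (u - t)) ((alg_step ns ^^ t) c)"
      using that(3) by (metis comp_apply funpow_add le_add_diff_inverse2)
    thus ?thesis using that alg_stays by simp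
  qed
  obtain t u where "(alg_step ns ^^ t) (Step1 (s_star ns)) = Stop h"
      "(alg_step ns ^^ u) (Step1 (s_star ns)) = Stop h'"
    using assms by (auto simp: alg_stops_at_def)
  thus ?thesis using *[of t _ h u h'] *[of u _ h' t h] by (metis nle_le)
qed

definition least_obstruction :: "nat list \<Rightarrow> nat" where
  "least_obstruction ns = (LEAST h. 0 < h \<and> obstructs ns h)"

lemma least_obstruction:
  assumes len: "2 \<le> length ns" and pos: "\<forall>n\<in>set ns. 0 < n"
  shows "0 < least_obstruction ns" "obstructs ns (least_obstruction ns)"
    "\<And>q. 0 < q \<Longrightarrow> q < least_obstruction ns \<Longrightarrow> \<not> obstructs ns q"
    "s_star ns \<le> least_obstruction ns"
proof -
  have "obstructs ns (Suc (sum_list ns))"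
    by (rule obstructs_large[OF len pos]) (auto simp: less_Suc_eq_le member_le_sum_list)
  hence ex: "\<exists>h. 0 < h \<and> obstructs ns h" by blast
  show 1: "0 < least_obstruction ns" "obstructs ns (least_obstruction ns)"
    using LeastI_ex[OF ex] by (auto simp: least_obstruction_def)
  show "\<And>q. 0 < q \<Longrightarrow> q < least_obstruction ns \<Longrightarrow> \<not> obstructs ns q"
    unfolding least_obstruction_def using not_less_Least by blast
  show "s_star ns \<le> least_obstruction ns"
    using not_obstructs_below_s_star[OF 1(1)] 1(2) by (meson not_less)
qed

lemma alg_stops_at_iff:
  assumes len: "2 \<le> length ns" and pos: "\<forall>n\<in>set ns. 0 < n"
  shows "alg_stops_at ns h \<longleftrightarrow> h = least_obstruction ns"
proof -
  note lo = least_obstruction[OF len pos]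
  have "ns \<noteq> []" using len by auto
  hence s: "0 < s_star ns" using pos by (rule s_star_pos)
  have "\<not> obstructs ns q" if "s_star ns \<le> q" "q < least_obstruction ns" for q
    using lo(3)[of q] s that by simp
  then obtain t where "(alg_step ns ^^ t) (Step1 (s_star ns)) = Step1 (least_obstruction ns)"
    using alg_reaches[OF s lo(4)] by blast
  hence "(alg_step ns ^^ (3 + t)) (Step1 (s_star ns)) = Stop (least_obstruction ns)"
    unfolding funpow_add using alg_round[OF lo(1), of ns] lo(2) by simp
  hence "alg_stops_at ns (least_obstruction ns)" unfolding alg_stops_at_def by blast
  thus ?thesis using alg_stops_at_unique by blast
qed

section \<open>Running time\<close>

definition reaches :: "nat list \<Rightarrow> nat \<Rightarrow> machine \<Rightarrow> machine \<Rightarrow> bool" where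
  "reaches ns b x y \<longleftrightarrow> (\<exists>t\<le>b. (machine_step ns ^^ t) x = y)"

lemma reaches_refl: "reaches ns 0 x x"
  by (simp add: reaches_def)

lemma reaches_step: "machine_step ns x = y \<Longrightarrow> reaches ns 1 x y"
  unfolding reaches_def by (rule exI[of _ 1]) simp

lemma reaches_trans:
  assumes "reaches ns a x y" "reaches ns b y z"
  shows "reaches ns (a + b) x z"
proof -
  obtain t u where "t \<le> a" "(machine_step ns ^^ t) x = y" "u \<le> b" "(machine_step ns ^^ u) y = z"
    using assms by (auto simp: reaches_def)
  hence "u + t \<le> a + b" "(machine_step ns ^^ (u + t)) x = z" by (auto simp: funpow_add)
  thus ?thesis unfolding reaches_def by blast
qed

lemma reaches_mono: "reaches ns a x y \<Longrightarrow> a \<le> b \<Longrightarrow> reaches ns b x y"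
  unfolding reaches_def using le_trans by blast

lemma reaches_trial_division:
  assumes "i < length ns" "0 < s" "s \<le> least_nondivisor (ns ! i)"
  shows "reaches ns (s - 1) (Init i 1 m) (Init i s m)"
  using assms(2,3)
proof (induction s rule: nat_induct_non_zero)
  case 1
  show ?case using reaches_refl by simp
next
  case (Suc s)
  have "s dvd ns ! i" using Suc dvd_if_less_least_nondivisor by simp
  hence "reaches ns 1 (Init i s m) (Init i (Suc s) m)"
    using assms(1) by (intro reaches_step) simp
  hence "reaches ns (s - 1 + 1) (Init i 1 m) (Init i (Suc s) m)"
    using Suc by (intro reaches_trans[OF Suc.IH]) auto
  thus ?case using Suc by simp
qed

text \<open>
  The least non-divisor of \<open>n\<close> is at most \<open>n + 1\<close>, which bounds the trial divisions for one
  entry. The value 0 of the third argument marks the empty minimum; it cannot be confused with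
  a proper minimum because least non-divisors are positive.
\<close>

lemma reaches_init_entries:
  assumes pos: "\<forall>n\<in>set ns. 0 < n" and "i \<le> length ns"
  shows "reaches ns (\<Sum>j<i. ns ! j + 1) (Init 0 1 0)
    (Init i 1 (if i = 0 then 0 else Min ((\<lambda>j. least_nondivisor (ns ! j)) ` {..<i})))"
  using assms(2)
proof (induction i)
  case 0
  show ?case using reaches_refl by simp
next
  case (Suc i)
  let ?s = "least_nondivisor (ns ! i)"
  let ?M = "\<lambda>i. if i = 0 then 0 else Min ((\<lambda>j. least_nondivisor (ns ! j)) ` {..<i})"
  have i: "i < length ns" using Suc by simp
  have p: "0 < ns ! j" if "j \<le> i" for j using pos i that by simp
  note s = least_nondivisor_props[OF p]
  have M0: "?M i \<noteq> 0" if "i \<noteq> 0"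
  proof -
    have "?M i \<in> (\<lambda>j. least_nondivisor (ns ! j)) ` {..<i}"
      using that by (simp add: lessThan_empty_iff)
    thus ?thesis using s(1) by fastforce
  qed
  have "reaches ns (?s - 1) (Init i 1 (?M i)) (Init i ?s (?M i))"
    using i s by (intro reaches_trial_division) auto
  moreover have "machine_step ns (Init i ?s (?M i)) = Init (Suc i) 1 (?M (Suc i))"
  proof (cases "i = 0")
    case True
    thus ?thesis using i s(2)[of 0] by (simp add: lessThan_Suc)
  next
    case False
    have "?M (Suc i) = min ?s (?M i)"
      using False by (simp add: lessThan_Suc lessThan_empty_iff)
    thus ?thesis using i s(2)[of i] M0[OF False] False by (simp add: min.commute)
  qed
  ultimately have "reaches ns (?s - 1 + 1) (Init i 1 (?M i)) (Init (Suc i) 1 (?M (Suc i)))"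
    using reaches_trans reaches_step by blast
  hence "reaches ns (ns ! i + 1) (Init i 1 (?M i)) (Init (Suc i) 1 (?M (Suc i)))"
    using s(1)[of i] s(3)[of i] by (elim reaches_mono) simp
  thus ?case
    using reaches_trans[OF Suc.IH] i by (simp only: sum.lessThan_Suc less_imp_le)
qed

lemma reaches_init:
  assumes pos: "\<forall>n\<in>set ns. 0 < n" and ne: "ns \<noteq> []"
  shows "reaches ns ((\<Sum>j<length ns. ns ! j + 1) + 1) (Init 0 1 0) (Scan (s_star ns) 0 None)"
proof (rule reaches_trans)
  have "{least_nondivisor (ns ! i) |i. i < length ns} =
      (\<lambda>j. least_nondivisor (ns ! j)) ` {..<length ns}" by auto
  thus "reaches ns (\<Sum>j<length ns. ns ! j + 1) (Init 0 1 0) (Init (length ns) 1 (s_star ns))"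
    using reaches_init_entries[OF pos, of "length ns"] ne by (simp add: s_star_def)
  show "reaches ns 1 (Init (length ns) 1 (s_star ns)) (Scan (s_star ns) 0 None)"
    by (rule reaches_step) simp
qed

text \<open>
  The remembered index is the only one scanned so far whose entry is not divisible by \<open>h\<close>; a
  second such entry halts the machine before the scan is complete.
\<close>

lemma machine_scan:
  assumes "i \<le> length ns"
  shows "(machine_step ns ^^ i) (Scan h 0 None) = Halt h \<and>
        (\<exists>a<length ns. \<exists>b<length ns. a \<noteq> b \<and> \<not> h dvd ns ! a \<and> \<not> h dvd ns ! b) \<or>
      (\<exists>u. (machine_step ns ^^ i) (Scan h 0 None) = Scan h i u \<and>
        {j. j < i \<and> \<not> h dvd ns ! j} = set_option u)"
  using assms
proof (induction i)
  case 0
  show ?case by simp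
next
  case (Suc i)
  hence i: "i < length ns" by simp
  from Suc consider
      "(machine_step ns ^^ i) (Scan h 0 None) = Halt h"
      "\<exists>a<length ns. \<exists>b<length ns. a \<noteq> b \<and> \<not> h dvd ns ! a \<and> \<not> h dvd ns ! b"
    | u where "(machine_step ns ^^ i) (Scan h 0 None) = Scan h i u"
      "{j. j < i \<and> \<not> h dvd ns ! j} = set_option u"
    by auto
  thus ?case
  proof cases
    case 1
    thus ?thesis by simp
  next
    case (2 u)
    have split: "{j. j < Suc i \<and> \<not> h dvd ns ! j} =
        {j. j < i \<and> \<not> h dvd ns ! j} \<union> (if h dvd ns ! i then {} else {i})"
      by (auto simp: less_Suc_eq)
    show ?thesis
    proof (cases "h dvd ns ! i")
      case True
      thus ?thesis using 2 i split by simp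
    next
      case ndvd: False
      show ?thesis
      proof (cases u)
        case None
        have "{j. j < Suc i \<and> \<not> h dvd ns ! j} = {i}"
          unfolding split 2(2) using None ndvd by simp
        thus ?thesis using 2(1) None i ndvd by simp
      next
        case (Some j)
        hence "j < i" "\<not> h dvd ns ! j" using 2(2) by auto
        hence "\<exists>a<length ns. \<exists>b<length ns. a \<noteq> b \<and> \<not> h dvd ns ! a \<and> \<not> h dvd ns ! b"
          using i ndvd by (intro exI[of _ j] exI[of _ i]) auto
        thus ?thesis using 2 i ndvd Some by simp
      qed
    qed
  qed
qed

text \<open>
  The extra three steps are the one that leaves the scan, the test, and the increment.
\<close>

lemma machine_round:
  "reaches ns (length ns + 3) (Scan h 0 None)
     (if obstructs ns h then Halt h else Scan (h + 1) 0 None)"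
proof -
  let ?end = "if obstructs ns h then Halt h else Scan (h + 1) 0 None"
  let ?l = "length ns"
  have incr: "reaches ns 1 (Incr h) (Scan (h + 1) 0 None)" by (rule reaches_step) simp
  consider
      "(machine_step ns ^^ ?l) (Scan h 0 None) = Halt h" "obstructs ns h"
    | u where "(machine_step ns ^^ ?l) (Scan h 0 None) = Scan h ?l u"
      "{j. j < ?l \<and> \<not> h dvd ns ! j} = set_option u"
    using machine_scan[of ?l ns h] unfolding obstructs_def by blast
  thus ?thesis
  proof cases
    case 1
    hence "reaches ns ?l (Scan h 0 None) ?end" unfolding reaches_def by auto
    thus ?thesis by (rule reaches_mono) simp
  next
    case (2 u)
    have scan: "reaches ns ?l (Scan h 0 None) (Scan h ?l u)"
      unfolding reaches_def using 2 by blast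
    have "reaches ns 3 (Scan h ?l u) ?end"
    proof (cases u)
      case None
      hence "\<not> obstructs ns h" using 2(2) by (auto simp: obstructs_def)
      moreover have "reaches ns 1 (Scan h ?l u) (Incr h)" using None by (intro reaches_step) simp
      ultimately show ?thesis
        using reaches_mono[OF reaches_trans[OF _ incr], of 1 _ 3] by simp
    next
      case (Some j)
      have j: "i < ?l \<and> \<not> h dvd ns ! i \<longleftrightarrow> i = j" for i using 2(2) Some by auto
      hence obs: "obstructs ns h \<longleftrightarrow> (h + 1) * (ns ! j div h) < ns ! j"
        unfolding obstructs_def by metis
      have test: "reaches ns 1 (Scan h ?l u) (Test h j)"
        using Some by (intro reaches_step) simp
      have "reaches ns 2 (Test h j) ?end"
      proof (cases "obstructs ns h")
        case True
        hence "reaches ns 1 (Test h j) ?end" using obs by (intro reaches_step) simp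
        thus ?thesis by (rule reaches_mono) simp
      next
        case False
        hence "reaches ns 1 (Test h j) (Incr h)" using obs by (intro reaches_step) simp
        from reaches_trans[OF this incr] show ?thesis using False by (simp add: numeral_2_eq_2)
      qed
      thus ?thesis using reaches_trans[OF test] by fastforce
    qed
    thus ?thesis by (rule reaches_trans[OF scan])
  qed
qed

lemma reaches_rounds:
  assumes "s \<le> h" "\<And>q. s \<le> q \<Longrightarrow> q < h \<Longrightarrow> \<not> obstructs ns q"
  shows "reaches ns ((h - s) * (length ns + 3)) (Scan s 0 None) (Scan h 0 None)"
  using assms
proof (induction h rule: dec_induct)
  case base
  show ?case using reaches_refl by simp
next
  case (step h)
  have "reaches ns ((h - s) * (length ns + 3) + (length ns + 3)) (Scan s 0 None) (Scan (h + 1) 0 None)"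
  proof (rule reaches_trans)
    show "reaches ns ((h - s) * (length ns + 3)) (Scan s 0 None) (Scan h 0 None)"
      using step by auto
    show "reaches ns (length ns + 3) (Scan h 0 None) (Scan (h + 1) 0 None)"
      using step.hyps step.prems[of h] machine_round[of ns h] by simp
  qed
  moreover have "(h - s) * (length ns + 3) + (length ns + 3) = (Suc h - s) * (length ns + 3)"
    using step.hyps by (simp add: Suc_diff_le)
  ultimately show ?case by simp
qed

text \<open>
  Each of the at least \<open>l - 1\<close> sizes divisible by \<open>h\<close> is positive, hence at least \<open>h\<close>.
\<close>

lemma not_obstructs_bound:
  assumes pos: "\<forall>n\<in>set ns. 0 < n" and free: "\<not> obstructs ns h"
  shows "(length ns - 1) * h \<le> (\<Sum>i<length ns. ns ! i)"
proof -
  let ?D = "{i. i < length ns \<and> \<not> h dvd ns ! i}" and ?E = "{i. i < length ns \<and> h dvd ns ! i}"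
  have "{..<length ns} = ?D \<union> ?E" by auto
  hence "length ns = card (?D \<union> ?E)" by (metis card_lessThan)
  also have "\<dots> = card ?D + card ?E" by (rule card_Un_disjoint) auto
  finally have "(length ns - 1) * h \<le> card ?E * h"
    using card_nondivisible_le_1[OF free] by (intro mult_le_mono1) simp
  also have "\<dots> \<le> (\<Sum>i\<in>?E. ns ! i)"
    using pos sum_bounded_below[of ?E h "\<lambda>i. ns ! i"] by (auto simp: dvd_imp_le)
  also have "\<dots> \<le> (\<Sum>i<length ns. ns ! i)"
    by (rule sum_mono2) auto
  finally show ?thesis .
qed

text \<open>
  With \<open>l\<close> parts and \<open>N \<ge> l \<ge> 2\<close> vertices: initialization takes at most \<open>N + l + 1\<close> steps,
  the passed rounds together at most \<open>5 N\<close>, and the last round \<open>l + 3\<close>, in total at most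
  \<open>8 N + 4 \<le> 10 N\<close>.
\<close>

lemma machine_halts_linear:
  assumes len: "2 \<le> length ns" and pos: "\<forall>n\<in>set ns. 0 < n"
  shows "reaches ns (10 * (\<Sum>i<length ns. ns ! i)) (Init 0 1 0) (Halt (least_obstruction ns))"
proof -
  let ?h = "least_obstruction ns" and ?l = "length ns" and ?s = "s_star ns"
  let ?N = "\<Sum>i<length ns. ns ! i"
  note lo = least_obstruction[OF len pos]
  have ne: "ns \<noteq> []" using len by auto
  have s: "0 < ?s" using s_star_pos[OF ne pos] .
  have "reaches ns ((?h - ?s) * (?l + 3)) (Scan ?s 0 None) (Scan ?h 0 None)"
    using lo s by (intro reaches_rounds) auto
  moreover have "reaches ns (?l + 3) (Scan ?h 0 None) (Halt ?h)"
    using machine_round[of ns ?h] lo by simp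
  ultimately have run: "reaches ns ((\<Sum>j<?l. ns ! j + 1) + 1 + ((?h - ?s) * (?l + 3) + (?l + 3)))
      (Init 0 1 0) (Halt ?h)"
    using reaches_trans reaches_init[OF pos ne] by blast
  have "(\<Sum>i<?l. 1) \<le> ?N"
    using pos by (intro sum_mono) (auto simp: Suc_le_eq)
  hence l: "?l \<le> ?N" by simp
  \<comment> \<open>The last passed value is \<open>?h - 1\<close>, and \<open>l + 3 \<le> 5 (l - 1)\<close> since \<open>l \<ge> 2\<close>.\<close>
  have rounds: "(?h - ?s) * (?l + 3) \<le> 5 * ?N"
  proof (cases "?h - ?s = 0")
    case False
    have "(?h - ?s) * (?l + 3) \<le> (?h - 1) * (5 * (?l - 1))"
      using s len by (intro mult_le_mono) auto
    also have "\<dots> = 5 * ((?l - 1) * (?h - 1))" by simp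
    also have "\<dots> \<le> 5 * ?N"
    proof -
      have "\<not> obstructs ns (?h - 1)" using lo(3)[of "?h - 1"] False s by simp
      thus ?thesis using not_obstructs_bound[OF pos, of "?h - 1"] by simp
    qed
    finally show ?thesis .
  qed simp
  have "(\<Sum>j<?l. ns ! j + 1) = ?N + ?l" by (subst sum.distrib) simp
  hence "(\<Sum>j<?l. ns ! j + 1) + 1 + ((?h - ?s) * (?l + 3) + (?l + 3)) \<le> 10 * ?N"
    using rounds l len by linarith
  thus ?thesis using reaches_mono[OF run] by blast
qed

section \<open>The threshold computed in linear time\<close>

theorem mainTheorem2:
  shows "(\<forall>ns. 2 \<le> length ns \<and> (\<forall>n\<in>set ns. 0 < n) \<longrightarrow>
            (\<exists>!h. alg_stops_at ns h) \<and>
            (\<forall>h. alg_stops_at ns h \<longrightarrow>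
               int (equitable_threshold (complete_multipartite ns)) =
                 (\<Sum>i<length ns. \<lceil>real (ns ! i) / real h\<rceil>)))
       \<and> (\<exists>c. \<forall>ns. 2 \<le> length ns \<and> (\<forall>n\<in>set ns. 0 < n) \<longrightarrow>
            (\<forall>h. alg_stops_at ns h \<longrightarrow>
               machine_halts_within ns h (c * card (pverts (complete_multipartite ns)))))"
proof (intro conjI exI[of _ 10] allI impI; elim conjE)
  fix ns :: "nat list"
  assume ns: "2 \<le> length ns" "\<forall>n\<in>set ns. 0 < n"
  note iff = alg_stops_at_iff[OF ns]
  show "\<exists>!h. alg_stops_at ns h" unfolding iff by simp
  fix h assume "alg_stops_at ns h"
  hence h: "h = least_obstruction ns" using iff by simp
  show "int (equitable_threshold (complete_multipartite ns)) =
      (\<Sum>i<length ns. \<lceil>real (ns ! i) / real h\<rceil>)"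
    using equitable_threshold_eq[OF ns least_obstruction(1-3)[OF ns]]
    by (simp add: h int_ceil_div)
  show "machine_halts_within ns h (10 * card (pverts (complete_multipartite ns)))"
    using machine_halts_linear[OF ns]
    by (simp add: h machine_halts_within_def reaches_def card_pverts_complete_multipartite)
qed

end
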